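(* Consider the single-input single-output system $\dot{\boldsymbol{x}}=\boldsymbol{f}(\boldsymbol{x})+\boldsymbol{g}(\boldsymbol{x})u$, $y=h(\boldsymbol{x})$, $\boldsymbol{x}(t_0)=\boldsymbol{x}_0$, with output constraint $y\in\mathcal{Y}=[y_{\min},y_{\max}]$, corresponding closed convex state constraint set $\mathcal{X}\subseteq\mathbb{R}^n$, well-defined relative degree $r$ with $0<r\le n$, and normal-form diffeomorphism $\boldsymbol{\phi}$, all as specified in the context. Let the performance function $J:\mathcal{X}\to\mathbb{R}$ be continuously differentiable and convex, with $L$-Lipschitz continuous gradient, i.e. $\|\nabla J(\boldsymbol{x})-\nabla J(\hat{\boldsymbol{x}})\|\le L\|\boldsymbol{x}-\hat{\boldsymbol{x}}\|$ for all $\boldsymbol{x},\hat{\boldsymbol{x}}\in\mathcal{X}$, and let $J$ have a minimizer over $\mathcal{X}$. Let $\epsilon>0$, $\varrho=\frac{2}{L+2\epsilon}$, $\boldsymbol{x}_0\in\mathcal{X}$, let $$\boldsymbol{x}_{k+1}=\Pi_{\mathcal{X}}\big(\boldsymbol{x}_k-\varrho\nabla J(\boldsymbol{x}_k)\big),\qquad k=0,1,2,\dots,$$ and let $t_0<t_1<t_2<\cdots$ be time instants. If a trajectory $\boldsymbol{\eta}^*$ (together with a parameter vector $\boldsymbol{p}\in\mathbb{R}^{n-r}$) satisfying the two-point boundary value problem for the internal dynamics described in the context exists on each interval $[t_k,t_{k+1}]$, then the extremum seeking control scheme, which applies on each $[t_k,t_{k+1}]$ the inversion-based feedforward input $u^*$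 defined in the context, generates for the system the state sequence $\{\boldsymbol{x}_k\}_{k\in\mathbb{N}}$ (that is, it steers the state from $\boldsymbol{x}(t_k)=\boldsymbol{x}_k$ to $\boldsymbol{x}(t_{k+1})=\boldsymbol{x}_{k+1}$), and this sequence globally (i.e. from any starting point $\boldsymbol{x}_0\in\mathcal{X}$) asymptotically converges to a minimizer of $J$ over $\mathcal{X}$.
   Context: **System.** $\boldsymbol{x}\in\mathbb{R}^n$ is the state, $u\in\mathbb{R}$ the input, $y\in\mathbb{R}$ the output. The maps $\boldsymbol{f},\boldsymbol{g}$ (with values in $\mathbb{R}^n$) and $h$ (with values in $\mathbb{R}$) are continuously differentiable, and smooth enough for the Lie derivatives and the diffeomorphism below to make sense. The function $h$ is convex, $\mathcal{Y}=[y_{\min},y_{\max}]$ with $y_{\min}<y_{\max}$, and $\mathcal{X}=\{\boldsymbol{x}: h(\boldsymbol{x})\in\mathcal{Y}\}$ is assumed to be a nonempty closed convex set. $\Pi_{\mathcal{X}}(\boldsymbol{z})=\mathrm{argmin}_{\boldsymbol{x}\in\mathcal{X}}\frac12\|\boldsymbol{x}-\boldsymbol{z}\|^2$ is the Euclidean projection onto $\mathcal{X}$. **Input-output normal form.** $\mathcal{L}_{\boldsymbol{f}}^0h=h$ and $\mathcal{L}_{\boldsymbol{f}}^ih(\boldsymbol{x})=\frac{\partial(\mathcal{L}_{\boldsymbol{f}}^{i-1}h(\boldsymbol{x}))}{\partial\boldsymbol{x}}\cdot\boldsymbol{f}(\boldsymbol{x})$. The relative degree $r$ is the number of times $y$ has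 to be differentiated until $u$ appears explicitly. The change of coordinates $$[y,\dot y,\dots,y^{(r-1)},\boldsymbol{\eta}^\top]^\top=\boldsymbol{\phi}(\boldsymbol{x})=[\phi_1(\boldsymbol{x}),\dots,\phi_n(\boldsymbol{x})]^\top$$ is a diffeomorphism, with $\phi_{i+1}=\mathcal{L}_{\boldsymbol{f}}^ih$ for $i=0,\dots,r-1$, and $\boldsymbol{\eta}=[\eta_{r+1},\dots,\eta_n]^\top=[\phi_{r+1}(\boldsymbol{x}),\dots,\phi_n(\boldsymbol{x})]^\top\in\mathbb{R}^{n-r}$ with $\frac{\partial\phi_j}{\partial\boldsymbol{x}}\boldsymbol{g}=0$ for $j=r+1,\dots,n$. In these coordinates the system reads $$y^{(r)}=\alpha(y,\dot y,\dots,y^{(r-1)},\boldsymbol{\eta},u),\qquad \dot{\boldsymbol{\eta}}=\boldsymbol{\beta}(y,\dot y,\dots,y^{(r-1)},\boldsymbol{\eta},u),$$ the second equation being the internal dynamics (not assumed stable). Inverting the first relation with respect to $u$ is written $u=\alpha^{-1}(y,\dots,y^{(r)},\boldsymbol{\eta})$. **Reference output on $[t_k,t_{k+1}]$.** Let $\Delta_k=t_{k+1}-t_k>0$. Fix $\delta_y>0$ and put $y^{\mathrm s}_{\min}=y_{\min}-\delta_y$, $y^{\mathrm s}_{\max}=y_{\max}+\delta_y$, $\rho=\frac{4}{y^{\mathrm s}_{\max}-y^{\mathrm s}_{\min}}$, and $$\varphi(\zeta)=y^{\mathrm s}_{\max}-\frac{y^{\mathrm s}_{\max}-y^{\mathrm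 s}_{\min}}{1+\exp(\rho\zeta)}.$$ Let $y_\kappa=h(\boldsymbol{x}_\kappa)$ and $\zeta_\kappa=\varphi^{-1}(y_\kappa)=\frac1\rho\left[\log(y_\kappa-y^{\mathrm s}_{\min})-\log(y^{\mathrm s}_{\max}-y_\kappa)\right]$ for $\kappa=k,k+1$. With tuning parameters $\gamma_i>0$ and free parameters $\boldsymbol{p}=(p_1,\dots,p_{n-r})$, the virtual output trajectory is $$\zeta(t,\boldsymbol{p})=\zeta_k+\Big(\zeta_{k+1}-\zeta_k-\sum_{i=1}^{n-r}\gamma_ip_i\Big)\frac{t-t_k}{\Delta_k}+\sum_{i=1}^{n-r}\gamma_ip_i\Big(\frac{t-t_k}{\Delta_k}\Big)^2,$$ so that $\zeta(t_k,\boldsymbol{p})=\zeta_k$ and $\zeta(t_{k+1},\boldsymbol{p})=\zeta_{k+1}$. The reference output is $y^*(t)=\varphi(\zeta(t,\boldsymbol{p}))$; it satisfies $y^*(t_k)=y_k$ and $y^*(t_{k+1})=y_{k+1}$. **Boundary value problem on $[t_k,t_{k+1}]$.** Find $\boldsymbol{p}$ and $\boldsymbol{\eta}^*:[t_k,t_{k+1}]\to\mathbb{R}^{n-r}$ such that $$\dot{\boldsymbol{\eta}}^*=\boldsymbol{\beta}(y^*,\dot y^*,\dots,y^{*(r-1)},\boldsymbol{\eta}^*,u^* ),\qquad u^*=\alpha^{-1}(y^*,\dots,y^{*(r)},\boldsymbol{\eta}^* ),$$ subject to $$\boldsymbol{\eta}^*(t_\kappa)=\boldsymbol{\eta}_\kappa=[\phi_{r+1}(\boldsymbol{x}_\kappa),\dots,\phi_n(\boldsymbol{x}_\kappa)]^\top,\quad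 \kappa=k,k+1.$$ The input applied on $[t_k,t_{k+1}]$ is $u^*(t)=\alpha^{-1}(y^*(t),\dots,y^{*(r)}(t),\boldsymbol{\eta}^*(t))$.
   Formalization: For relative degree r ≥ 2 the claim as stated fails, so it is additionally assumed that at both ends of each interval the derivatives of the reference output of orders 1 to r−1 equal the Lie derivatives of h along f at x_k and x_{k+1}; for r = 1 nothing is added. *)

theory Defs
  imports "HOL-Analysis.Analysis"
begin

definition C1_on :: "('a::real_normed_vector \<Rightarrow> 'b::real_normed_vector) \<Rightarrow> 'a set \<Rightarrow> bool" where
  "C1_on F S \<longleftrightarrow> (\<exists>F'. continuous_on S F' \<and>
      (\<forall>x\<in>S. (F has_derivative blinfun_apply (F' x)) (at x within S)))"

text \<open>A diffeomorphism onto an open image, which need not be the whole space.\<close>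

definition C1_diffeo :: "('a::real_normed_vector \<Rightarrow> 'b::real_normed_vector) \<Rightarrow> bool" where
  "C1_diffeo F \<longleftrightarrow> inj F \<and> open (range F) \<and> C1_on F UNIV \<and> C1_on (inv F) (range F)"

definition lie :: "('a::real_normed_vector \<Rightarrow> 'a) \<Rightarrow> ('a \<Rightarrow> real) \<Rightarrow> 'a \<Rightarrow> real" where
  "lie F q x = frechet_derivative q (at x) (F x)"

text \<open>
  Along the control system, the derivative of \<open>(lie f ^^ i) h\<close> is
  \<open>(lie f ^^ Suc i) h + u * lie g ((lie f ^^ i) h)\<close>. Hence the input first appears in
  the derivative of order \<open>r\<close> of the output, and does so at every state, under the
  following conditions.
\<close>

definition relative_degree ::
    "('a::real_normed_vector \<Rightarrow> 'a) \<Rightarrow> ('a \<Rightarrow> 'a) \<Rightarrow> ('a \<Rightarrow> real) \<Rightarrow> nat \<Rightarrow> bool" where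
  "relative_degree f g h r \<longleftrightarrow> 0 < r \<and>
     (\<forall>i<r. \<forall>x. (lie f ^^ i) h differentiable (at x)) \<and>
     (\<forall>i. Suc i < r \<longrightarrow> (\<forall>x. lie g ((lie f ^^ i) h) x = 0)) \<and>
     (\<forall>x. lie g ((lie f ^^ (r - 1)) h) x \<noteq> 0)"

text \<open>
  Throughout, \<open>ix\<close> is an enumeration of the index type by \<open>{1..CARD('n)}\<close>, so that
  \<open>v $ ix i\<close> is the \<open>i\<close>-th coordinate of \<open>v\<close>, counted from 1. Vectors with entries
  indexed by \<open>r+1, ..., n\<close> are functions on \<open>nat\<close> of which only these values matter.
\<close>

definition normal_form ::
    "(nat \<Rightarrow> 'n) \<Rightarrow> (real^'n \<Rightarrow> real^'n) \<Rightarrow> (real^'n \<Rightarrow> real^'n) \<Rightarrow> (real^'n \<Rightarrow> real) \<Rightarrow> nat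
      \<Rightarrow> (real^'n \<Rightarrow> real^'n::finite) \<Rightarrow> bool" where
  "normal_form ix f g h r \<Phi> \<longleftrightarrow> C1_diffeo \<Phi> \<and>
     (\<forall>i<r. \<forall>x. \<Phi> x $ ix (Suc i) = (lie f ^^ i) h x) \<and>
     (\<forall>j\<in>{r+1..CARD('n)}. \<forall>x. lie g (\<lambda>x. \<Phi> x $ ix j) x = 0)"

text \<open>
  The \<open>i\<close>-th component of the system in the new coordinates, at the point \<open>z\<close> in
  \<open>range \<Phi>\<close>: the derivative of the \<open>i\<close>-th coordinate of \<open>\<Phi>\<close> along \<open>f + u g\<close>.
\<close>

definition nf_rate ::
    "(nat \<Rightarrow> 'n) \<Rightarrow> (real^'n \<Rightarrow> real^'n) \<Rightarrow> (real^'n \<Rightarrow> real^'n) \<Rightarrow> (real^'n \<Rightarrow> real^'n::finite)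
      \<Rightarrow> nat \<Rightarrow> real^'n \<Rightarrow> real \<Rightarrow> real" where
  "nf_rate ix f g \<Phi> i z u = lie (\<lambda>x. f x + u *\<^sub>R g x) (\<lambda>x. \<Phi> x $ ix i) (inv \<Phi> z)"

definition nf_alpha ::
    "(nat \<Rightarrow> 'n) \<Rightarrow> (real^'n \<Rightarrow> real^'n) \<Rightarrow> (real^'n \<Rightarrow> real^'n) \<Rightarrow> (real^'n \<Rightarrow> real^'n::finite)
      \<Rightarrow> nat \<Rightarrow> real^'n \<Rightarrow> real \<Rightarrow> real" where
  "nf_alpha ix f g \<Phi> r z u = nf_rate ix f g \<Phi> r z u"

definition nf_beta ::
    "(nat \<Rightarrow> 'n) \<Rightarrow> (real^'n \<Rightarrow> real^'n) \<Rightarrow> (real^'n \<Rightarrow> real^'n) \<Rightarrow> (real^'n \<Rightarrow> real^'n::finite)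
      \<Rightarrow> nat \<Rightarrow> real^'n \<Rightarrow> real \<Rightarrow> real" where
  "nf_beta ix f g \<Phi> j z u = nf_rate ix f g \<Phi> j z u"

definition nf_alpha_inv ::
    "(nat \<Rightarrow> 'n) \<Rightarrow> (real^'n \<Rightarrow> real^'n) \<Rightarrow> (real^'n \<Rightarrow> real^'n) \<Rightarrow> (real^'n \<Rightarrow> real^'n::finite)
      \<Rightarrow> nat \<Rightarrow> real^'n \<Rightarrow> real \<Rightarrow> real" where
  "nf_alpha_inv ix f g \<Phi> r z v = (THE u. nf_alpha ix f g \<Phi> r z u = v)"

text \<open>The vector with coordinates \<open>y s, y' s, ..., y^(r-1) s, e s (r+1), ..., e s n\<close>.\<close>

definition nf_point ::
    "(nat \<Rightarrow> 'n) \<Rightarrow> nat \<Rightarrow> (real \<Rightarrow> real) \<Rightarrow> (real \<Rightarrow> nat \<Rightarrow> real) \<Rightarrow> real \<Rightarrow> real^'n::finite" where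
  "nf_point ix r y e s =
     (\<chi> c. let i = the_inv_into {1..CARD('n)} ix c
           in if i \<le> r then (deriv ^^ (i - 1)) y s else e s i)"

definition sat :: "real \<Rightarrow> real \<Rightarrow> real \<Rightarrow> real" where
  "sat lo hi \<zeta> = hi - (hi - lo) / (1 + exp ((4 / (hi - lo)) * \<zeta>))"

definition sat_inv :: "real \<Rightarrow> real \<Rightarrow> real \<Rightarrow> real" where
  "sat_inv lo hi y = (1 / (4 / (hi - lo))) * (ln (y - lo) - ln (hi - y))"

definition virtual_output ::
    "nat \<Rightarrow> (nat \<Rightarrow> real) \<Rightarrow> (nat \<Rightarrow> real) \<Rightarrow> real \<Rightarrow> real \<Rightarrow> real \<Rightarrow> real \<Rightarrow> real \<Rightarrow> real" where
  "virtual_output m \<gamma> p a b \<zeta>a \<zeta>b s =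
     \<zeta>a + (\<zeta>b - \<zeta>a - (\<Sum>i=1..m. \<gamma> i * p i)) * ((s - a) / (b - a))
        + (\<Sum>i=1..m. \<gamma> i * p i) * ((s - a) / (b - a))\<^sup>2"

definition ref_output ::
    "real \<Rightarrow> real \<Rightarrow> nat \<Rightarrow> (nat \<Rightarrow> real) \<Rightarrow> (nat \<Rightarrow> real)
      \<Rightarrow> real \<Rightarrow> real \<Rightarrow> real \<Rightarrow> real \<Rightarrow> real \<Rightarrow> real" where
  "ref_output lo hi m \<gamma> p a b ya yb s =
     sat lo hi (virtual_output m \<gamma> p a b (sat_inv lo hi ya) (sat_inv lo hi yb) s)"

definition ff_input ::
    "(nat \<Rightarrow> 'n) \<Rightarrow> (real^'n \<Rightarrow> real^'n) \<Rightarrow> (real^'n \<Rightarrow> real^'n) \<Rightarrow> (real^'n \<Rightarrow> real^'n::finite)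
      \<Rightarrow> nat \<Rightarrow> (real \<Rightarrow> real) \<Rightarrow> (real \<Rightarrow> nat \<Rightarrow> real) \<Rightarrow> real \<Rightarrow> real" where
  "ff_input ix f g \<Phi> r y e s =
     nf_alpha_inv ix f g \<Phi> r (nf_point ix r y e s) ((deriv ^^ r) y s)"

text \<open>
  The first condition says that the curve stays in the domain \<open>range \<Phi>\<close> on which the
  system in the new coordinates is defined; it is void if \<open>\<Phi>\<close> is surjective.
\<close>

definition bvp_solution ::
    "(nat \<Rightarrow> 'n) \<Rightarrow> (real^'n \<Rightarrow> real^'n) \<Rightarrow> (real^'n \<Rightarrow> real^'n) \<Rightarrow> (real^'n \<Rightarrow> real^'n::finite)
      \<Rightarrow> nat \<Rightarrow> real \<Rightarrow> real \<Rightarrow> real^'n \<Rightarrow> real^'n \<Rightarrow> (real \<Rightarrow> real) \<Rightarrow> (real \<Rightarrow> nat \<Rightarrow> real) \<Rightarrow> bool" where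
  "bvp_solution ix f g \<Phi> r a b xa xb y e \<longleftrightarrow>
     (\<forall>s\<in>{a..b}. nf_point ix r y e s \<in> range \<Phi>) \<and>
     (\<forall>s\<in>{a..b}. \<forall>j\<in>{r+1..CARD('n)}.
        ((\<lambda>s. e s j) has_real_derivative
          nf_beta ix f g \<Phi> j (nf_point ix r y e s) (ff_input ix f g \<Phi> r y e s))
          (at s within {a..b})) \<and>
     (\<forall>j\<in>{r+1..CARD('n)}. e a j = \<Phi> xa $ ix j \<and> e b j = \<Phi> xb $ ix j)"

text \<open>
  A state trajectory under the inputs \<open>u k\<close>, applied on \<open>{t k..t (Suc k)}\<close>. The inputs of
  two adjacent intervals may differ at the common end point, where only the one-sided
  derivatives are prescribed.
\<close>

definition state_trajectory ::
    "('a::real_normed_vector \<Rightarrow> 'a) \<Rightarrow> ('a \<Rightarrow> 'a) \<Rightarrow> (nat \<Rightarrow> real) \<Rightarrow> (nat \<Rightarrow> real \<Rightarrow> real)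
      \<Rightarrow> (real \<Rightarrow> 'a) \<Rightarrow> bool" where
  "state_trajectory f g t u \<xi> \<longleftrightarrow>
     (\<forall>k. \<forall>s\<in>{t k..t (Suc k)}.
        (\<xi> has_vector_derivative f (\<xi> s) + u k s *\<^sub>R g (\<xi> s)) (at s within {t k..t (Suc k)}))"

end

theory Submission
  imports Defs
begin

text \<open>
  The statement has two parts that meet only in the sequence \<open>x\<close>.

  Convergence of \<open>x\<close>. The step \<open>2 / (L + 2 \<epsilon>)\<close> is chosen so that combining the descent lemma with
  the variational inequality of the projection lowers \<open>J\<close> by at least
  \<open>\<epsilon> \<parallel>x (k+1) - x k\<parallel>\<^sup>2\<close> in each step; hence the squared increments are summable. The same two
  facts, together with the tangent inequality for \<open>J\<close>, show that the squared distance to any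
  minimizer grows by at most a multiple of the squared increment, and that the gaps
  \<open>J (x (k+1)) - min J\<close> are summable. So cluster points are minimizers, and a quasi-Fejer argument
  makes the whole sequence converge to one of them (\<open>projected_gradient_converges\<close>). Only
  derivatives of \<open>J\<close> relative to \<open>X\<close> enter. In particular the usual cocoercivity of the gradient,
  which would call for a gradient on the whole space, is avoided.

  Steering the state. On each interval, reading the curve \<open>(y, y', ..., y^(r-1), \<eta>)\<close> back through
  the diffeomorphism gives a state curve. It solves the system under the feedforward input: in the
  first \<open>r - 1\<close> coordinates because these are iterated derivatives on both sides, in coordinate \<open>r\<close>
  by the definition of the input, and in the remaining ones by the boundary value problem
  (\<open>feedforward_solves_system\<close>). Its end points are \<open>x k\<close> and \<open>x (k+1)\<close>, so the pieces fit
  together to one trajectory. Any other trajectory with the same start agrees with it, because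
  \<open>f + u g\<close> is Lipschitz on bounded sets, uniformly in time, as \<open>u\<close> is continuous on each
  interval (\<open>control_affine_solution_unique\<close>).
\<close>

section \<open>Projected gradient descent with a constant step\<close>

lemma has_derivative_along_segment:
  fixes F :: "'a::real_inner \<Rightarrow> real"
  assumes "convex X" "a \<in> X" "b \<in> X" "s \<in> {0..1}"
    and "(F has_derivative (\<lambda>v. G \<bullet> v)) (at (a + s *\<^sub>R (b - a)) within X)"
  shows "((\<lambda>s. F (a + s *\<^sub>R (b - a))) has_real_derivative G \<bullet> (b - a)) (at s within {0..1})"
proof -
  have seg: "(\<lambda>s. a + s *\<^sub>R (b - a)) ` {0..1} \<subseteq> X"
  proof clarify
    fix q :: real assume "q \<in> {0..1}"
    then have "(1 - q) *\<^sub>R a + q *\<^sub>R b \<in> X"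
      using assms(1-3) by (intro convexD) auto
    then show "a + q *\<^sub>R (b - a) \<in> X" by (simp add: algebra_simps)
  qed
  have "(F \<circ> (\<lambda>s. a + s *\<^sub>R (b - a)) has_derivative (\<lambda>v. G \<bullet> v) \<circ> (\<lambda>q. q *\<^sub>R (b - a)))
          (at s within {0..1})"
    by (rule diff_chain_within, (auto intro!: derivative_eq_intros)[1])
       (rule has_derivative_subset[OF assms(5) seg])
  then show ?thesis
    by (simp add: has_field_derivative_def o_def mult_commute_abs)
qed

text \<open>
  By convexity, all difference quotients of \<open>F\<close> along the segment from \<open>a\<close> to \<open>b\<close> are at most
  \<open>F b - F a\<close>, and they tend to the directional derivative. As the segment lies in \<open>X\<close>, a derivative
  relative to \<open>X\<close> suffices, also at boundary points.
\<close>

lemma convex_above_tangent: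
  fixes F :: "'a::real_inner \<Rightarrow> real"
  assumes "convex_on X F" "a \<in> X" "b \<in> X"
    and "(F has_derivative (\<lambda>v. G \<bullet> v)) (at a within X)"
  shows "F a + G \<bullet> (b - a) \<le> F b"
proof -
  let ?\<phi> = "\<lambda>s. F (a + s *\<^sub>R (b - a))"
  have "convex X" using assms(1) by (rule convex_on_imp_convex)
  then have "(?\<phi> has_real_derivative G \<bullet> (b - a)) (at 0 within {0..1})"
    by (rule has_derivative_along_segment) (use assms in auto)
  then have lim: "((\<lambda>s. (?\<phi> s - ?\<phi> 0) / (s - 0)) \<longlongrightarrow> G \<bullet> (b - a)) (at 0 within {0..1})"
    by (simp add: has_field_derivative_iff)
  have "G \<bullet> (b - a) \<le> F b - F a"
  proof (rule tendsto_upperbound[OF lim])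
    show "\<forall>\<^sub>F s in at 0 within {0..1}. (?\<phi> s - ?\<phi> 0) / (s - 0) \<le> F b - F a"
      unfolding eventually_at
    proof (intro exI[of _ 1] conjI ballI impI)
      fix s :: real assume s: "s \<in> {0..1}" "s \<noteq> 0 \<and> dist s 0 < 1"
      have "F ((1 - s) *\<^sub>R a + s *\<^sub>R b) \<le> (1 - s) * F a + s * F b"
        using assms(1-3) s by (intro convex_onD) auto
      then have "?\<phi> s - ?\<phi> 0 \<le> (F b - F a) * s" by (simp add: algebra_simps)
      then show "(?\<phi> s - ?\<phi> 0) / (s - 0) \<le> F b - F a"
        using s by (simp add: divide_le_eq)
    qed simp
    show "at (0::real) within {0..1} \<noteq> bot"
      by (simp add: at_within_Icc_at_right trivial_limit_at_right_real)
  qed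
  then show ?thesis by simp
qed

text \<open>
  The difference of the two sides, as a function of the position on the segment from \<open>a\<close> to \<open>b\<close>,
  has a derivative that the Lipschitz bound on \<open>G\<close> makes nonpositive.
\<close>

lemma descent_lemma:
  fixes F :: "'a::real_inner \<Rightarrow> real"
  assumes "convex X" "a \<in> X" "b \<in> X" "L-lipschitz_on X G"
    and G: "\<And>z. z \<in> X \<Longrightarrow> (F has_derivative (\<lambda>v. G z \<bullet> v)) (at z within X)"
  shows "F b \<le> F a + G a \<bullet> (b - a) + L / 2 * (norm (b - a))\<^sup>2"
proof -
  define \<psi> where "\<psi> = (\<lambda>s. F (a + s *\<^sub>R (b - a)) - s * (G a \<bullet> (b - a))
                          - L / 2 * s\<^sup>2 * (norm (b - a))\<^sup>2)"
  have seg: "a + s *\<^sub>R (b - a) \<in> X" if "s \<in> {0..1}" for s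
  proof -
    have "(1 - s) *\<^sub>R a + s *\<^sub>R b \<in> X" using assms(1-3) that by (intro convexD) auto
    then show ?thesis by (simp add: algebra_simps)
  qed
  have d: "(\<psi> has_real_derivative (G (a + s *\<^sub>R (b - a)) - G a) \<bullet> (b - a)
             - L * s * (norm (b - a))\<^sup>2) (at s within {0..1})" if "s \<in> {0..1}" for s
    unfolding \<psi>_def
    by (rule has_derivative_along_segment[OF assms(1-3) that G[OF seg[OF that]]]
        derivative_eq_intros refl | simp add: inner_diff_left)+
  have "\<exists>s\<in>{0<..<1}. \<psi> 1 - \<psi> 0 = ((G (a + s *\<^sub>R (b - a)) - G a) \<bullet> (b - a)
             - L * s * (norm (b - a))\<^sup>2) * (1 - 0)"
    by (rule mvt_simple) (use d in \<open>auto simp: has_field_derivative_def\<close>)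
  then obtain s where s: "s \<in> {0<..<1}"
    and \<psi>: "\<psi> 1 - \<psi> 0 = (G (a + s *\<^sub>R (b - a)) - G a) \<bullet> (b - a) - L * s * (norm (b - a))\<^sup>2"
    by auto
  have "(G (a + s *\<^sub>R (b - a)) - G a) \<bullet> (b - a) \<le> norm (G (a + s *\<^sub>R (b - a)) - G a) * norm (b - a)"
    by (rule norm_cauchy_schwarz)
  also have "\<dots> \<le> (L * norm (s *\<^sub>R (b - a))) * norm (b - a)"
    using lipschitz_onD[OF assms(4) seg[of s] assms(2)] s
    by (intro mult_right_mono) (auto simp: dist_norm)
  also have "\<dots> = L * s * (norm (b - a))\<^sup>2"
    using s by (simp add: power2_eq_square)
  finally have "\<psi> 1 \<le> \<psi> 0" using \<psi> by simp
  then show ?thesis by (simp add: \<psi>_def)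
qed

text \<open>
  Subtracting the partial sums of \<open>e\<close> from the squared distance to a point of \<open>M\<close> gives a bounded
  decreasing sequence; hence that squared distance converges. Taking for the point a cluster
  point of \<open>x\<close>, the limit has to be \<open>0\<close>.
\<close>

lemma quasi_Fejer_convergent:
  fixes x :: "nat \<Rightarrow> 'a::euclidean_space"
  assumes e: "summable e" "\<And>k. 0 \<le> e k"
    and "M \<noteq> {}"
    and qF: "\<And>z k. z \<in> M \<Longrightarrow> (norm (x (Suc k) - z))\<^sup>2 \<le> (norm (x k - z))\<^sup>2 + e k"
    and cluster: "\<And>\<sigma> z. strict_mono \<sigma> \<Longrightarrow> (x \<circ> \<sigma>) \<longlonglongrightarrow> z \<Longrightarrow> z \<in> M"
  shows "\<exists>z\<in>M. x \<longlonglongrightarrow> z"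
proof -
  define E where "E = (\<lambda>k. \<Sum>i<k. e i)"
  have E: "E \<longlonglongrightarrow> suminf e" unfolding E_def using e(1) by (rule summable_LIMSEQ)
  have E_le: "E k \<le> suminf e" for k unfolding E_def using e by (intro sum_le_suminf) auto
  have dec: "decseq (\<lambda>k. (norm (x k - z))\<^sup>2 - E k)" if "z \<in> M" for z
    by (rule decseq_SucI) (use qF[OF that] in \<open>simp add: E_def algebra_simps\<close>)
  obtain z0 where z0: "z0 \<in> M" using \<open>M \<noteq> {}\<close> by auto
  have "(norm (x k - z0))\<^sup>2 \<le> (norm (x 0 - z0))\<^sup>2 + suminf e" for k
    using decseqD[OF dec[OF z0], of 0 k] E_le[of k] by (simp add: E_def)
  then have "dist z0 (x k) \<le> sqrt ((norm (x 0 - z0))\<^sup>2 + suminf e)" for k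
    by (intro real_le_rsqrt) (simp add: dist_norm norm_minus_commute)
  then have "bounded (range x)" unfolding bounded_def by blast
  then obtain z \<sigma> where \<sigma>: "strict_mono \<sigma>" "(x \<circ> \<sigma>) \<longlonglongrightarrow> z"
    using bounded_imp_convergent_subsequence by blast
  have z: "z \<in> M" using cluster \<sigma> by blast
  have "convergent (\<lambda>k. (norm (x k - z))\<^sup>2 - E k)"
  proof (rule Bseq_monoseq_convergent)
    show "Bseq (\<lambda>k. (norm (x k - z))\<^sup>2 - E k)"
    proof (rule decseq_bounded[OF dec[OF z]])
      have "- suminf e \<le> (norm (x i - z))\<^sup>2 - E i" for i
        using E_le[of i] zero_le_power2[of "norm (x i - z)"] by linarith
      then show "\<forall>i. - suminf e \<le> (norm (x i - z))\<^sup>2 - E i" by blast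
    qed
    show "monoseq (\<lambda>k. (norm (x k - z))\<^sup>2 - E k)"
      using dec[OF z] by (simp add: monoseq_iff)
  qed
  then obtain l where "(\<lambda>k. (norm (x k - z))\<^sup>2 - E k) \<longlonglongrightarrow> l" by (auto simp: convergent_def)
  from tendsto_add[OF this E] have l: "(\<lambda>k. (norm (x k - z))\<^sup>2) \<longlonglongrightarrow> l + suminf e" by simp
  have "((\<lambda>k. (norm (x k - z))\<^sup>2) \<circ> \<sigma>) \<longlonglongrightarrow> (norm (z - z))\<^sup>2"
    using \<sigma>(2) unfolding o_def by (intro tendsto_intros)
  moreover have "((\<lambda>k. (norm (x k - z))\<^sup>2) \<circ> \<sigma>) \<longlonglongrightarrow> l + suminf e"
    using LIMSEQ_subseq_LIMSEQ[OF l \<sigma>(1)] .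
  ultimately have "l + suminf e = 0" using LIMSEQ_unique by fastforce
  with l have "(\<lambda>k. sqrt ((norm (x k - z))\<^sup>2)) \<longlonglongrightarrow> sqrt 0" by (intro tendsto_intros) simp
  then have "(\<lambda>k. norm (x k - z)) \<longlonglongrightarrow> 0" by simp
  then have "(\<lambda>k. x k - z) \<longlonglongrightarrow> 0" by (rule tendsto_norm_zero_cancel)
  then have "x \<longlonglongrightarrow> z" by (rule LIM_zero_cancel)
  with z show ?thesis by blast
qed

text \<open>
  For steps of length at most \<open>1 / L\<close> the distance to any minimizer would be nonincreasing by the
  same computation. The step here may come close to \<open>2 / L\<close>; this leaves an error proportional to
  the squared increment, which the decrease of the values makes summable.
\<close>

theorem projected_gradient_converges:
  fixes x :: "nat \<Rightarrow> 'a::euclidean_space" and F :: "'a \<Rightarrow> real"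
  assumes X: "closed X" "convex_on X F"
    and G: "\<And>z. z \<in> X \<Longrightarrow> (F has_derivative (\<lambda>v. G z \<bullet> v)) (at z within X)"
    and Lip: "L-lipschitz_on X G"
    and ex: "\<exists>z. is_arg_min F (\<lambda>z. z \<in> X) z"
    and eps: "\<epsilon> > 0" and step: "\<rho> = 2 / (L + 2 * \<epsilon>)"
    and x_0: "x 0 \<in> X"
    and x_Suc: "\<And>k. x (Suc k) = closest_point X (x k - \<rho> *\<^sub>R G (x k))"
  shows "\<exists>z. is_arg_min F (\<lambda>z. z \<in> X) z \<and> x \<longlonglongrightarrow> z"
proof -
  define M where "M = {z. is_arg_min F (\<lambda>z. z \<in> X) z}"
  have M: "z \<in> M \<longleftrightarrow> z \<in> X \<and> (\<forall>w\<in>X. F z \<le> F w)" for z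
    by (auto simp: M_def is_arg_min_linorder)
  have cX: "convex X" using X(2) by (rule convex_on_imp_convex)
  have L: "0 \<le> L" using Lip by (rule lipschitz_on_nonneg)
  then have \<rho>: "0 < \<rho>" "(L / 2 + \<epsilon>) * \<rho> = 1" using eps by (auto simp: step field_simps)
  have xX: "x k \<in> X" for k
    using x_0 by (cases k) (auto simp: x_Suc intro!: closest_point_in_set X(1))
  define d where "d = (\<lambda>k. x (Suc k) - x k)"
  define D where "D = (\<lambda>k. (norm (d k))\<^sup>2)"
  have D: "0 \<le> D k" for k by (simp add: D_def)
  \<comment> \<open>the obtuse angle property of the projection, expanded\<close>
  have variational: "D k + (d k) \<bullet> (x k - z) + \<rho> * (G (x k) \<bullet> (x (Suc k) - z)) \<le> 0"
    if "z \<in> X" for z k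
  proof -
    have "(x k - \<rho> *\<^sub>R G (x k) - x (Suc k)) \<bullet> (z - x (Suc k)) \<le> 0"
      unfolding x_Suc using closest_point_dot[OF cX X(1) that] by blast
    then show ?thesis
      by (simp add: D_def d_def power2_norm_eq_inner inner_diff_left inner_diff_right
          inner_commute algebra_simps)
  qed
  have descent: "F (x (Suc k)) \<le> F (x k) + G (x k) \<bullet> d k + L / 2 * D k" for k
    unfolding d_def D_def by (rule descent_lemma[OF cX xX xX Lip G])
  \<comment> \<open>the previous inequality at \<open>z = x k\<close>, scaled by \<open>1 / \<rho> = L / 2 + \<epsilon>\<close>: the part \<open>L / 2\<close>
    pays for the quadratic term of the descent lemma, and \<open>\<epsilon>\<close> is left over\<close>
  have decrease: "\<epsilon> * D k \<le> F (x k) - F (x (Suc k))" for k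
  proof -
    have "D k + \<rho> * (G (x k) \<bullet> d k) \<le> 0"
      using variational[OF xX, of k k] by (simp add: d_def)
    then have "(L / 2 + \<epsilon>) * (D k + \<rho> * (G (x k) \<bullet> d k)) \<le> 0"
      using L eps by (intro mult_nonneg_nonpos) auto
    then have "(L / 2 + \<epsilon>) * D k + ((L / 2 + \<epsilon>) * \<rho>) * (G (x k) \<bullet> d k) \<le> 0"
      by (simp add: algebra_simps)
    then show ?thesis using descent[of k] unfolding \<rho>(2) by (simp add: algebra_simps)
  qed
  \<comment> \<open>the gradient is evaluated at \<open>x k\<close>, but the value gap appears at \<open>x (Suc k)\<close>: the tangent
    inequality leads from \<open>z\<close> to \<open>x k\<close> and the descent lemma from there to \<open>x (Suc k)\<close>, at
    the price of \<open>L / 2 * D k\<close>\<close>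
  have Fejer: "(norm (x (Suc k) - z))\<^sup>2 + 2 * \<rho> * (F (x (Suc k)) - F z)
                 \<le> (norm (x k - z))\<^sup>2 + \<rho> * L * D k" if "z \<in> X" for z k
  proof -
    have "F (x k) + G (x k) \<bullet> (z - x k) \<le> F z"
      by (rule convex_above_tangent[OF X(2) xX that G[OF xX]])
    then have "F (x (Suc k)) - F z \<le> G (x k) \<bullet> (x (Suc k) - z) + L / 2 * D k"
      using descent[of k] by (simp add: d_def inner_diff_right)
    then have "\<rho> * (F (x (Suc k)) - F z) \<le> \<rho> * (G (x k) \<bullet> (x (Suc k) - z) + L / 2 * D k)"
      using \<rho>(1) by (intro mult_left_mono) auto
    moreover have "(norm (x (Suc k) - z))\<^sup>2 = (norm (x k - z))\<^sup>2 + 2 * (d k \<bullet> (x k - z)) + D k"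
      by (simp add: D_def d_def power2_norm_eq_inner inner_diff_left inner_diff_right
          inner_commute algebra_simps)
    ultimately show ?thesis
      using variational[OF that, of k] D[of k] by (simp add: algebra_simps)
  qed
  obtain z0 where z0: "z0 \<in> M" using ex by (auto simp: M_def)
  have sumD: "summable D"
  proof (rule bounded_imp_summable)
    show "(\<Sum>k\<le>n. D k) \<le> (F (x 0) - F z0) / \<epsilon>" for n
    proof -
      have "\<epsilon> * (\<Sum>k\<le>n. D k) \<le> (\<Sum>k\<le>n. F (x k) - F (x (Suc k)))"
        unfolding sum_distrib_left by (intro sum_mono decrease)
      also have "\<dots> = F (x 0) - F (x (Suc n))" by (rule sum_telescope)
      also have "\<dots> \<le> F (x 0) - F z0" using z0 xX by (simp add: M)
      finally show ?thesis using eps by (simp add: field_simps)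
    qed
  qed (rule D)
  define e where "e = (\<lambda>k. \<rho> * L * D k)"
  have e: "summable e" "0 \<le> e k" for k
    using sumD L \<rho>(1) D by (auto simp: e_def intro: summable_mult)
  have F_lim: "(\<lambda>k. F (x k)) \<longlonglongrightarrow> F z0"
  proof -
    have "summable (\<lambda>k. F (x (Suc k)) - F z0)"
    proof (rule bounded_imp_summable)
      show "0 \<le> F (x (Suc k)) - F z0" for k using z0 xX by (simp add: M)
      show "(\<Sum>k\<le>n. F (x (Suc k)) - F z0) \<le> ((norm (x 0 - z0))\<^sup>2 + suminf e) / (2 * \<rho>)" for n
      proof -
        have "2 * \<rho> * (\<Sum>k\<le>n. F (x (Suc k)) - F z0)
          \<le> (\<Sum>k\<le>n. ((norm (x k - z0))\<^sup>2 - (norm (x (Suc k) - z0))\<^sup>2) + e k)"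
          unfolding sum_distrib_left
          using Fejer[of z0] z0 by (intro sum_mono) (simp add: M e_def algebra_simps)
        also have "\<dots> = (norm (x 0 - z0))\<^sup>2 - (norm (x (Suc n) - z0))\<^sup>2 + (\<Sum>k\<le>n. e k)"
          using sum_telescope[of "\<lambda>k. (norm (x k - z0))\<^sup>2" n] by (simp only: sum.distrib)
        also have "\<dots> \<le> (norm (x 0 - z0))\<^sup>2 + suminf e"
          using sum_le_suminf[of e "{..n}"] e by (simp add: add_increasing2 diff_le_eq)
        finally show ?thesis using \<rho>(1) by (simp add: field_simps)
      qed
    qed
    then have "(\<lambda>k. F (x (Suc k)) - F z0) \<longlonglongrightarrow> 0" by (rule summable_LIMSEQ_zero)
    then have "(\<lambda>k. F (x (Suc k))) \<longlonglongrightarrow> F z0" by (rule LIM_zero_cancel)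
    then show ?thesis by (rule LIMSEQ_imp_Suc)
  qed
  have "\<exists>z\<in>M. x \<longlonglongrightarrow> z"
  proof (rule quasi_Fejer_convergent[OF e])
    show "M \<noteq> {}" using z0 by auto
    show "(norm (x (Suc k) - z))\<^sup>2 \<le> (norm (x k - z))\<^sup>2 + e k" if "z \<in> M" for z k
    proof -
      have "0 \<le> 2 * \<rho> * (F (x (Suc k)) - F z)" using that xX \<rho>(1) by (simp add: M)
      then show ?thesis using Fejer[of z k] that by (simp add: M e_def)
    qed
    show "z \<in> M" if "strict_mono \<sigma>" "(x \<circ> \<sigma>) \<longlonglongrightarrow> z" for \<sigma> z
    proof -
      have z: "z \<in> X" using closed_sequentially[OF X(1) _ that(2)] xX by auto
      have "continuous_on X F" 
        using G by (intro has_derivative_continuous_on) auto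
      then have "(F \<circ> (x \<circ> \<sigma>)) \<longlonglongrightarrow> F z"
        using z that(2) xX by (auto simp: continuous_on_sequentially)
      moreover have "(F \<circ> (x \<circ> \<sigma>)) \<longlonglongrightarrow> F z0"
        using LIMSEQ_subseq_LIMSEQ[OF F_lim that(1)] by (simp add: o_def)
      ultimately have "F z = F z0" using LIMSEQ_unique by blast
      then show ?thesis using z z0 by (simp add: M)
    qed
  qed
  then show ?thesis by (auto simp: M_def)
qed

section \<open>Solutions of the controlled differential equation\<close>

text \<open>
  Gronwall's argument in differential form: the squared distance of two solutions has a derivative
  of at most \<open>2 K\<close> times itself, so with the weight \<open>exp (- 2 K s)\<close> it cannot increase from its
  initial value \<open>0\<close>.
\<close>

lemma has_vector_derivative_unique_solution:
  fixes v w :: "real \<Rightarrow> 'a::real_inner"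
  assumes v: "\<And>s. s \<in> {a..b} \<Longrightarrow> (v has_vector_derivative F s (v s)) (at s within {a..b})"
    and w: "\<And>s. s \<in> {a..b} \<Longrightarrow> (w has_vector_derivative F s (w s)) (at s within {a..b})"
    and S: "\<And>s. s \<in> {a..b} \<Longrightarrow> v s \<in> S" "\<And>s. s \<in> {a..b} \<Longrightarrow> w s \<in> S"
    and Lip: "\<And>s. s \<in> {a..b} \<Longrightarrow> K-lipschitz_on S (F s)"
    and init: "v a = w a" and s: "s \<in> {a..b}"
  shows "v s = w s"
proof (cases "a < s")
  case True
  define E where "E = (\<lambda>s. exp (- 2 * K * s) * ((v s - w s) \<bullet> (v s - w s)))"
  define E' where "E' = (\<lambda>s. exp (- 2 * K * s) *
      (2 * ((v s - w s) \<bullet> (F s (v s) - F s (w s))) - 2 * K * ((v s - w s) \<bullet> (v s - w s))))"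
  have d: "(E has_real_derivative E' q) (at q within {a..s})" if "q \<in> {a..s}" for q
  proof -
    have q: "q \<in> {a..b}" "{a..s} \<subseteq> {a..b}" using that s by auto
    have "((\<lambda>s. v s - w s) has_vector_derivative F q (v q) - F q (w q)) (at q within {a..s})"
      using has_vector_derivative_within_subset[OF v[OF q(1)] q(2)]
        has_vector_derivative_within_subset[OF w[OF q(1)] q(2)]
      by (rule has_vector_derivative_diff)
    from has_derivative_inner[OF this[unfolded has_vector_derivative_def]
        this[unfolded has_vector_derivative_def]]
    have sq: "((\<lambda>s. (v s - w s) \<bullet> (v s - w s)) has_real_derivative
            2 * ((v q - w q) \<bullet> (F q (v q) - F q (w q)))) (at q within {a..s})"
      unfolding has_field_derivative_def
      by (rule has_derivative_eq_rhs) (auto simp: inner_commute algebra_simps)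
    have ex: "((\<lambda>s. exp (- 2 * K * s)) has_real_derivative exp (- 2 * K * q) * (- 2 * K))
        (at q within {a..s})"
      by (auto intro!: derivative_eq_intros)
    show ?thesis unfolding E_def E'_def
      by (rule DERIV_cong[OF DERIV_mult[OF ex sq]]) (simp add: right_diff_distrib)
  qed
  have "\<exists>q\<in>{a<..<s}. E s - E a = E' q * (s - a)"
    by (rule mvt_simple[OF True]) (use d in \<open>auto simp: has_field_derivative_def\<close>)
  then obtain q where q: "q \<in> {a<..<s}" "E s - E a = E' q * (s - a)" by auto
  have qb: "q \<in> {a..b}" using q(1) s by auto
  have "(v q - w q) \<bullet> (F q (v q) - F q (w q)) \<le> norm (v q - w q) * norm (F q (v q) - F q (w q))"
    by (rule norm_cauchy_schwarz)
  also have "\<dots> \<le> norm (v q - w q) * (K * norm (v q - w q))"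
    using lipschitz_onD[OF Lip[OF qb] S(1)[OF qb] S(2)[OF qb]]
    by (intro mult_left_mono) (auto simp: dist_norm)
  also have "\<dots> = K * ((v q - w q) \<bullet> (v q - w q))"
    by (simp add: power2_norm_eq_inner[symmetric] power2_eq_square)
  finally have "E' q \<le> 0" unfolding E'_def by (intro mult_nonneg_nonpos) auto
  then have "E' q * (s - a) \<le> 0" using True by (intro mult_nonpos_nonneg) auto
  with q(2) have "E s \<le> E a" by simp
  also have "E a = 0" using init by (simp add: E_def)
  finally have "(v s - w s) \<bullet> (v s - w s) \<le> 0" unfolding E_def by (simp add: mult_le_0_iff)
  then show ?thesis using inner_ge_zero[of "v s - w s"] by (simp only: order_antisym_conv) simp
next
  case False
  then show ?thesis using s init by auto
qed

lemma C1_on_imp_continuous_on: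
  assumes "C1_on F S"
  shows "continuous_on S F"
  using assms by (auto simp: C1_on_def intro: has_derivative_continuous_on)

lemma C1_on_imp_lipschitz_on:
  assumes "C1_on F UNIV" "compact S" "convex S"
  shows "\<exists>K\<ge>0. K-lipschitz_on S F"
proof -
  obtain F' where F': "continuous_on UNIV F'"
    and d: "\<And>x. (F has_derivative blinfun_apply (F' x)) (at x)"
    using assms(1) by (auto simp: C1_on_def)
  have "compact (F' ` S)"
    by (rule compact_continuous_image[OF continuous_on_subset[OF F'] assms(2)]) simp
  then have "bounded (F' ` S)" by (rule compact_imp_bounded)
  then obtain K where K: "K > 0" "\<And>x. x \<in> S \<Longrightarrow> norm (F' x) \<le> K"
    by (auto simp: bounded_pos)
  have "norm (F x - F y) \<le> K * norm (x - y)" if "x \<in> S" "y \<in> S" for x y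
    by (rule differentiable_bound[OF assms(3) has_derivative_at_withinI[OF d] _ that(1,2)])
       (use K(2) in \<open>simp add: norm_blinfun.rep_eq\<close>)
  then show ?thesis using K(1)
    by (intro exI[of _ K] conjI lipschitz_onI) (auto simp: dist_norm)
qed

text \<open>
  Both solutions stay in a common ball, on which \<open>f\<close> and \<open>g\<close> are Lipschitz, and \<open>u\<close> is bounded;
  so the time-dependent field \<open>f + u g\<close> has one Lipschitz constant there for all times.
\<close>

lemma control_affine_solution_unique:
  fixes f g :: "'a::euclidean_space \<Rightarrow> 'a"
  assumes C1: "C1_on f UNIV" "C1_on g UNIV" and u: "continuous_on {a..b} u"
    and v: "\<And>s. s \<in> {a..b} \<Longrightarrow>
              (v has_vector_derivative f (v s) + u s *\<^sub>R g (v s)) (at s within {a..b})"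
    and w: "\<And>s. s \<in> {a..b} \<Longrightarrow>
              (w has_vector_derivative f (w s) + u s *\<^sub>R g (w s)) (at s within {a..b})"
    and init: "v a = w a" and s: "s \<in> {a..b}"
  shows "v s = w s"
proof -
  have "compact (v ` {a..b} \<union> w ` {a..b})"
    using v w by (intro compact_Un compact_continuous_image continuous_on_vector_derivative) auto
  then have "bounded (v ` {a..b} \<union> w ` {a..b})" by (rule compact_imp_bounded)
  then obtain R where R: "\<And>z. z \<in> v ` {a..b} \<union> w ` {a..b} \<Longrightarrow> norm z \<le> R"
    unfolding bounded_iff by blast
  obtain Kf Kg where K: "Kf-lipschitz_on (cball 0 R) f" "Kg-lipschitz_on (cball 0 R) g" "0 \<le> Kg"
    using C1_on_imp_lipschitz_on[OF C1(1), of "cball 0 R"]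
      C1_on_imp_lipschitz_on[OF C1(2), of "cball 0 R"] by auto
  have "bounded (u ` {a..b})" using u by (intro compact_imp_bounded compact_continuous_image) auto
  then obtain U where U: "\<And>s. s \<in> {a..b} \<Longrightarrow> \<bar>u s\<bar> \<le> U"
    unfolding bounded_iff by fastforce
  have Lip: "(Kf + U * Kg)-lipschitz_on (cball 0 R) (\<lambda>z. f z + u q *\<^sub>R g z)"
    if "q \<in> {a..b}" for q
  proof (rule lipschitz_on_mono)
    show "(Kf + \<bar>u q\<bar> * Kg)-lipschitz_on (cball 0 R) (\<lambda>z. f z + u q *\<^sub>R g z)"
      using K by (intro lipschitz_intros)
    show "Kf + \<bar>u q\<bar> * Kg \<le> Kf + U * Kg"
      using U[OF that] K(3) by (intro add_left_mono mult_right_mono)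
  qed simp
  show ?thesis
    by (rule has_vector_derivative_unique_solution
          [where F = "\<lambda>q z. f z + u q *\<^sub>R g z", OF v w _ _ Lip init s]) (use R in auto)
qed

text \<open>
  The intervals need not cover the real line, as \<open>t\<close> may be bounded, and adjacent ones share an
  end point. Choosing the least index \<open>k\<close> with \<open>s \<le> t (Suc k)\<close> settles both: at a shared end point
  it picks the earlier piece, and there the pieces agree.
\<close>

lemma glue_pieces:
  fixes t :: "nat \<Rightarrow> real"
  assumes t: "\<And>k. t k < t (Suc k)" and match: "\<And>k. \<Xi> k (t (Suc k)) = \<Xi> (Suc k) (t (Suc k))"
  shows "\<exists>\<xi>. \<forall>k. \<forall>s\<in>{t k..t (Suc k)}. \<xi> s = \<Xi> k s"
proof -
  define \<xi> where "\<xi> = (\<lambda>s. \<Xi> (LEAST k. s \<le> t (Suc k)) s)"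
  have mono: "strict_mono t" using t by (simp add: strict_mono_Suc_iff)
  have "\<xi> s = \<Xi> k s" if s: "s \<in> {t k..t (Suc k)}" for k s
  proof (cases "s = t k \<and> k > 0")
    case True
    then obtain j where j: "k = Suc j" "s = t (Suc j)" by (cases k) auto
    have "(LEAST k. s \<le> t (Suc k)) = j"
      unfolding j(2) by (rule Least_equality) (auto simp: strict_mono_less_eq[OF mono])
    then show ?thesis using match[of j] by (simp add: \<xi>_def j)
  next
    case False
    have "(LEAST k. s \<le> t (Suc k)) = k"
    proof (rule Least_equality)
      fix j assume j: "s \<le> t (Suc j)"
      show "k \<le> j"
      proof (rule ccontr)
        assume "\<not> k \<le> j"
        then have "t (Suc j) \<le> t k" by (simp add: strict_mono_less_eq[OF mono])
        then show False using j s False \<open>\<not> k \<le> j\<close> by auto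
      qed
    qed (use s in auto)
    then show ?thesis by (simp add: \<xi>_def)
  qed
  then show ?thesis by blast
qed

section \<open>The reference output\<close>

text \<open>
  The value of \<open>deriv\<close> means nothing where a derivative fails to exist, so existence has to be
  secured at every order. This is automatic for the members of a class of
  functions that contains a derivative of each of its members.
\<close>

lemma higher_deriv_of_closed_class:
  assumes "\<And>F. F \<in> \<F> \<Longrightarrow> \<exists>F'\<in>\<F>. \<forall>s. (F has_real_derivative F' s) (at s)" and "F \<in> \<F>"
  shows "(deriv ^^ i) F \<in> \<F> \<and>
         (\<forall>s. ((deriv ^^ i) F has_real_derivative (deriv ^^ Suc i) F s) (at s))"
proof (induction i)
  case 0
  obtain F' where F': "\<forall>s. (F has_real_derivative F' s) (at s)" using assms by blast
  then have "deriv F = F'" by (auto intro: DERIV_imp_deriv)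
  then show ?case using F' assms(2) by simp
next
  case (Suc i)
  obtain F' where "F' \<in> \<F>" and F': "\<forall>s. ((deriv ^^ i) F has_real_derivative F' s) (at s)"
    using assms(1) Suc by blast
  then have eq: "(deriv ^^ Suc i) F = F'" by (auto intro: DERIV_imp_deriv)
  obtain F'' where F'': "\<forall>s. (F' has_real_derivative F'' s) (at s)"
    using assms(1)[OF \<open>F' \<in> \<F>\<close>] by blast
  then have "(deriv ^^ Suc (Suc i)) F = F''" using eq by (auto intro: DERIV_imp_deriv)
  then show ?case using eq F'' \<open>F' \<in> \<F>\<close> by auto
qed

text \<open>
  The functions \<open>s \<mapsto> P (s, w s)\<close> with a polynomial \<open>P\<close> in two variables. The reference output
  belongs to this class if \<open>w\<close> is the logistic function of the virtual output, and the class
  contains the derivatives of its members as soon as it contains \<open>w'\<close>.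
\<close>

inductive_set generated_ring :: "(real \<Rightarrow> real) \<Rightarrow> (real \<Rightarrow> real) set" for w where
  const: "(\<lambda>_. c) \<in> generated_ring w"
| ident: "(\<lambda>s. s) \<in> generated_ring w"
| generator: "w \<in> generated_ring w"
| add: "F \<in> generated_ring w \<Longrightarrow> G \<in> generated_ring w \<Longrightarrow> (\<lambda>s. F s + G s) \<in> generated_ring w"
| mult: "F \<in> generated_ring w \<Longrightarrow> G \<in> generated_ring w \<Longrightarrow> (\<lambda>s. F s * G s) \<in> generated_ring w"

lemma generated_ring_closed_under_derivative:
  assumes "w' \<in> generated_ring w" "\<And>s. (w has_real_derivative w' s) (at s)"
    and "F \<in> generated_ring w"
  shows "\<exists>F'\<in>generated_ring w. \<forall>s. (F has_real_derivative F' s) (at s)"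
  using assms(3)
proof induction
  case (const c)
  show ?case by (rule bexI[of _ "\<lambda>_. 0"]) (auto intro: generated_ring.const)
next
  case ident
  show ?case by (rule bexI[of _ "\<lambda>_. 1"]) (auto intro: generated_ring.const)
next
  case generator
  show ?case using assms(1,2) by blast
next
  case (add F G)
  then obtain F' G' where "F' \<in> generated_ring w" "\<forall>s. (F has_real_derivative F' s) (at s)"
    "G' \<in> generated_ring w" "\<forall>s. (G has_real_derivative G' s) (at s)" by blast
  then show ?case
    by (intro bexI[of _ "\<lambda>s. F' s + G' s"])
       (auto intro!: generated_ring.intros derivative_eq_intros)
next
  case (mult F G)
  then obtain F' G' where "F' \<in> generated_ring w" "\<forall>s. (F has_real_derivative F' s) (at s)"
    "G' \<in> generated_ring w" "\<forall>s. (G has_real_derivative G' s) (at s)" by blast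
  with mult show ?case
    by (intro bexI[of _ "\<lambda>s. F' s * G s + F s * G' s"])
       (auto intro!: generated_ring.intros derivative_eq_intros)
qed

text \<open>
  With \<open>q\<close> the quadratic, \<open>w = 1 / (1 + exp (\<kappa> q))\<close> satisfies the logistic equation
  \<open>w' = \<kappa> q' w (w - 1)\<close>, whose right-hand side is a polynomial in \<open>s\<close> and \<open>w\<close>.
\<close>

lemma sat_quadratic_smooth:
  "((deriv ^^ i) (\<lambda>s. sat lo hi (c0 + c1 * s + c2 * s\<^sup>2)) has_real_derivative
     (deriv ^^ Suc i) (\<lambda>s. sat lo hi (c0 + c1 * s + c2 * s\<^sup>2)) s) (at s)"
proof -
  define \<kappa> where "\<kappa> = 4 / (hi - lo)"
  define w where "w = (\<lambda>s. inverse (1 + exp (\<kappa> * (c0 + c1 * s + c2 * s\<^sup>2))))"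
  define w' where "w' = (\<lambda>s. (\<kappa> * (c1 + 2 * c2 * s)) * (w s * (w s + -1)))"
  have pos: "1 + exp q \<noteq> 0" for q :: real using exp_gt_zero[of q] by linarith
  have w': "w' \<in> generated_ring w"
    unfolding w'_def by (intro generated_ring.intros)
  have dw: "(w has_real_derivative w' s) (at s)" for s
    unfolding w_def w'_def
    by (rule derivative_eq_intros refl pos)+
       (use pos in \<open>simp add: field_simps\<close>)
  have "(\<lambda>s. hi + (- (hi - lo)) * w s) \<in> generated_ring w"
    by (intro generated_ring.intros)
  also have "(\<lambda>s. hi + (- (hi - lo)) * w s) = (\<lambda>s. sat lo hi (c0 + c1 * s + c2 * s\<^sup>2))"
    by (simp add: sat_def w_def \<kappa>_def divide_inverse algebra_simps)
  finally show ?thesis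
    using higher_deriv_of_closed_class[OF generated_ring_closed_under_derivative[OF w' dw]] by blast
qed

lemma ref_output_smooth:
  "((deriv ^^ i) (ref_output lo hi m \<gamma> p a b ya yb) has_real_derivative
     (deriv ^^ Suc i) (ref_output lo hi m \<gamma> p a b ya yb) s) (at s)"
proof -
  define A where "A = sat_inv lo hi ya"
  define B where "B = sat_inv lo hi yb - A - (\<Sum>i=1..m. \<gamma> i * p i)"
  define C where "C = (\<Sum>i=1..m. \<gamma> i * p i)"
  define k where "k = 1 / (b - a)"
  have "virtual_output m \<gamma> p a b A (sat_inv lo hi yb) s
          = (A - B * k * a + C * k\<^sup>2 * a\<^sup>2) + (B * k - 2 * C * k\<^sup>2 * a) * s + C * k\<^sup>2 * s\<^sup>2" for s
  proof -
    have "(s - a) / (b - a) = k * (s - a)" by (simp add: k_def)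
    then have "virtual_output m \<gamma> p a b A (sat_inv lo hi yb) s
        = A + B * (k * (s - a)) + C * (k * (s - a))\<^sup>2"
      by (simp add: virtual_output_def B_def C_def)
    then show ?thesis by (simp add: power2_eq_square algebra_simps)
  qed
  then have "ref_output lo hi m \<gamma> p a b ya yb = (\<lambda>s. sat lo hi
      ((A - B * k * a + C * k\<^sup>2 * a\<^sup>2) + (B * k - 2 * C * k\<^sup>2 * a) * s + (C * k\<^sup>2) * s\<^sup>2))"
    by (simp add: fun_eq_iff ref_output_def A_def[symmetric])
  then show ?thesis by (simp only: sat_quadratic_smooth)
qed

lemma sat_sat_inv:
  assumes "lo < v" "v < hi"
  shows "sat lo hi (sat_inv lo hi v) = v"
proof -
  have "4 / (hi - lo) * sat_inv lo hi v = ln (v - lo) - ln (hi - v)"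
    using assms by (simp add: sat_inv_def)
  then have "exp (4 / (hi - lo) * sat_inv lo hi v) = (v - lo) / (hi - v)"
    using assms by (simp add: exp_diff)
  then have "1 + exp (4 / (hi - lo) * sat_inv lo hi v) = (hi - lo) / (hi - v)"
    using assms by (simp only:) (simp add: field_simps)
  then show ?thesis using assms by (simp add: sat_def)
qed

lemma ref_output_endpoints:
  assumes "a < b" "lo < ya" "ya < hi" "lo < yb" "yb < hi"
  shows "ref_output lo hi m \<gamma> p a b ya yb a = ya" "ref_output lo hi m \<gamma> p a b ya yb b = yb"
  using assms by (simp_all add: ref_output_def virtual_output_def sat_sat_inv)

section \<open>Inversion in normal form coordinates\<close>

lemma nf_point_nth:
  fixes ix :: "nat \<Rightarrow> 'n::finite"
  assumes "bij_betw ix {1..CARD('n)} UNIV" "i \<in> {1..CARD('n)}"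
  shows "nf_point ix r y e s $ ix i = (if i \<le> r then (deriv ^^ (i - 1)) y s else e s i)"
  using assms by (simp add: nf_point_def the_inv_into_f_f bij_betw_def)

lemma vec_eq_enum:
  fixes ix :: "nat \<Rightarrow> 'n::finite"
  assumes "bij_betw ix {1..CARD('n)} UNIV" "\<And>i. i \<in> {1..CARD('n)} \<Longrightarrow> v $ ix i = w $ ix i"
  shows "v = w"
proof -
  have "v $ c = w $ c" for c
  proof -
    have "c \<in> ix ` {1..CARD('n)}" using bij_betw_imp_surj_on[OF assms(1)] by simp
    then show ?thesis using assms(2) by auto
  qed
  then show ?thesis by (simp add: vec_eq_iff)
qed

lemma lie_component:
  assumes "(\<Phi> has_derivative D) (at x)"
  shows "lie F (\<lambda>x. \<Phi> x $ c) x = D (F x) $ c"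
proof -
  have "((\<lambda>x. \<Phi> x $ c) has_derivative (\<lambda>v. D v $ c)) (at x)"
    using bounded_linear.has_derivative[OF bounded_linear_vec_nth assms] .
  then show ?thesis by (simp add: lie_def frechet_derivative_at[symmetric])
qed

text \<open>
  Openness of the image turns the derivative of the inverse relative to the image into a genuine
  one; the chain rule then makes it a left inverse of the derivative of \<open>\<Phi>\<close>.
\<close>

lemma C1_diffeo_derivatives:
  assumes "C1_diffeo \<Phi>"
  obtains D D' where "continuous_on UNIV D"
    "\<And>x. (\<Phi> has_derivative blinfun_apply (D x)) (at x)"
    "\<And>z. z \<in> range \<Phi> \<Longrightarrow> (inv \<Phi> has_derivative blinfun_apply (D' z)) (at z)"
    "\<And>x v. blinfun_apply (D' (\<Phi> x)) (blinfun_apply (D x) v) = v"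
proof -
  have inj: "inj \<Phi>" and op: "open (range \<Phi>)" using assms by (auto simp: C1_diffeo_def)
  obtain D where D: "continuous_on UNIV D" "\<And>x. (\<Phi> has_derivative blinfun_apply (D x)) (at x)"
    using assms by (auto simp: C1_diffeo_def C1_on_def)
  obtain D' where within:
    "\<And>z. z \<in> range \<Phi> \<Longrightarrow> (inv \<Phi> has_derivative blinfun_apply (D' z)) (at z within range \<Phi>)"
    using assms unfolding C1_diffeo_def C1_on_def by blast
  have D': "(inv \<Phi> has_derivative blinfun_apply (D' z)) (at z)" if "z \<in> range \<Phi>" for z
    using within[OF that] unfolding at_within_open[OF that op] .
  have "blinfun_apply (D' (\<Phi> x)) (blinfun_apply (D x) v) = v" for x v
  proof -
    have "(inv \<Phi> \<circ> \<Phi> has_derivative blinfun_apply (D' (\<Phi> x)) \<circ> blinfun_apply (D x)) (at x)"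
      by (rule diff_chain_at[OF D(2) D']) simp
    then have "((\<lambda>x. x) has_derivative blinfun_apply (D' (\<Phi> x)) \<circ> blinfun_apply (D x)) (at x)"
      using inj by (simp add: o_def)
    then have "blinfun_apply (D' (\<Phi> x)) \<circ> blinfun_apply (D x) = (\<lambda>v. v)"
      using has_derivative_ident has_derivative_unique by blast
    from fun_cong[OF this, of v] show ?thesis by simp
  qed
  with D D' show ?thesis using that by blast
qed

text \<open>
  In the new coordinates the curve \<open>nf_point\<close> has velocity \<open>D (f + u g)\<close>, with \<open>D\<close> the derivative of
  \<open>\<Phi>\<close>, and applying the derivative of the inverse of \<open>\<Phi>\<close> removes \<open>D\<close>. The velocity is checked
  coordinate by coordinate: below \<open>r\<close> the Lie derivatives along \<open>g\<close> vanish and both sides are the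
  next coordinate; at \<open>r\<close> the input is made to fit, the factor of \<open>u\<close> being nonzero; above \<open>r\<close>
  it is the differential equation for \<open>e\<close>. Continuity of \<open>u\<close>, needed for uniqueness of
  trajectories, can be read off from the explicit quotient \<open>u_eq\<close>, since the Lie derivatives in it
  come from a continuously differentiable \<open>\<Phi>\<close>.
\<close>

lemma feedforward_solves_system:
  fixes f g :: "real^'n \<Rightarrow> real^'n::finite" and ix :: "nat \<Rightarrow> 'n"
  assumes ix: "bij_betw ix {1..CARD('n)} UNIV"
    and C1: "C1_on f UNIV" "C1_on g UNIV"
    and r: "r \<le> CARD('n)" "relative_degree f g h r" and nf: "normal_form ix f g h r \<Phi>"
    and y: "\<And>i s. ((deriv ^^ i) y has_real_derivative (deriv ^^ Suc i) y s) (at s)"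
    and bvp: "bvp_solution ix f g \<Phi> r a b xa xb y e"
    and ya: "\<And>i. i < r \<Longrightarrow> (deriv ^^ i) y a = (lie f ^^ i) h xa"
    and yb: "\<And>i. i < r \<Longrightarrow> (deriv ^^ i) y b = (lie f ^^ i) h xb"
    and u: "u = ff_input ix f g \<Phi> r y e"
  defines "\<xi> \<equiv> \<lambda>s. inv \<Phi> (nf_point ix r y e s)"
  shows "\<xi> a = xa" "\<xi> b = xb"
    "\<And>s. s \<in> {a..b} \<Longrightarrow>
       (\<xi> has_vector_derivative f (\<xi> s) + u s *\<^sub>R g (\<xi> s)) (at s within {a..b})"
    "continuous_on {a..b} u"
proof -
  let ?z = "nf_point ix r y e"
  have diffeo: "C1_diffeo \<Phi>"
    and out: "\<And>i. i < r \<Longrightarrow> (\<lambda>x. \<Phi> x $ ix (Suc i)) = (lie f ^^ i) h"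
    using nf by (auto simp: normal_form_def)
  then have inj: "inj \<Phi>" by (simp add: C1_diffeo_def)
  obtain D D' where cD: "continuous_on UNIV D"
    and D: "\<And>x. (\<Phi> has_derivative blinfun_apply (D x)) (at x)"
    and D': "\<And>z. z \<in> range \<Phi> \<Longrightarrow> (inv \<Phi> has_derivative blinfun_apply (D' z)) (at z)"
    and D'D: "\<And>x v. blinfun_apply (D' (\<Phi> x)) (blinfun_apply (D x) v) = v"
    using C1_diffeo_derivatives[OF diffeo] by blast
  have r0: "0 < r" and lg0: "\<And>i x. Suc i < r \<Longrightarrow> lie g ((lie f ^^ i) h) x = 0"
    and lgr: "\<And>x. lie g ((lie f ^^ (r - 1)) h) x \<noteq> 0"
    using r(2) by (auto simp: relative_degree_def)
  have range: "s \<in> {a..b} \<Longrightarrow> ?z s \<in> range \<Phi>" for s using bvp by (simp add: bvp_solution_def)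
  have \<Phi>\<xi>: "\<Phi> (\<xi> s) = ?z s" if "s \<in> {a..b}" for s
    unfolding \<xi>_def using range[OF that] by (rule f_inv_into_f)
  have \<xi>z: "inv \<Phi> (?z s) = \<xi> s" for s by (simp add: \<xi>_def)
  have rate: "nf_rate ix f g \<Phi> i z v = D (inv \<Phi> z) (f (inv \<Phi> z)) $ ix i
                + v * D (inv \<Phi> z) (g (inv \<Phi> z)) $ ix i" for i z v
    by (simp add: nf_rate_def lie_component[OF D] blinfun.add_right blinfun.scaleR_right)
  have Df: "D x (f x) $ ix (Suc i) = (lie f ^^ Suc i) h x" if "i < r" for i x
    using lie_component[OF D, where F = f and c = "ix (Suc i)"] out[OF that] by simp
  have Dg: "D x (g x) $ ix (Suc i) = lie g ((lie f ^^ i) h) x" if "i < r" for i x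
    using lie_component[OF D, where F = g and c = "ix (Suc i)"] out[OF that] by simp
  have Dgr: "D x (g x) $ ix r \<noteq> 0" for x
    using Dg[of "r - 1" x] lgr[of x] r0 by simp
  have u_eq: "u s = ((deriv ^^ r) y s - D (\<xi> s) (f (\<xi> s)) $ ix r) / (D (\<xi> s) (g (\<xi> s)) $ ix r)" for s
    unfolding u ff_input_def nf_alpha_inv_def nf_alpha_def rate \<xi>z
    by (rule the_equality) (use Dgr in \<open>auto simp: field_simps\<close>)
  have end_point: "\<xi> c = xc"
    if "\<And>i. i < r \<Longrightarrow> (deriv ^^ i) y c = (lie f ^^ i) h xc"
      "\<And>j. j \<in> {r+1..CARD('n)} \<Longrightarrow> e c j = \<Phi> xc $ ix j" for c xc
  proof -
    have "?z c = \<Phi> xc"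
    proof (rule vec_eq_enum[OF ix])
      fix i assume i: "i \<in> {1..CARD('n)}"
      then show "?z c $ ix i = \<Phi> xc $ ix i"
      proof (cases "i \<le> r")
        case True
        then have "i - 1 < r" "Suc (i - 1) = i" using i by auto
        then show ?thesis using that(1) nf_point_nth[OF ix i, of r y e c] True
            fun_cong[OF out[of "i - 1"], of xc] by simp
      next
        case False
        then show ?thesis using that(2)[of i] nf_point_nth[OF ix i, of r y e c] i by simp
      qed
    qed
    then show ?thesis using inj by (simp add: \<xi>_def)
  qed
  show "\<xi> a = xa" by (rule end_point[OF ya]) (use bvp in \<open>auto simp: bvp_solution_def\<close>)
  show "\<xi> b = xb" by (rule end_point[OF yb]) (use bvp in \<open>auto simp: bvp_solution_def\<close>)
  have dz: "(?z has_vector_derivative D (\<xi> s) (f (\<xi> s) + u s *\<^sub>R g (\<xi> s))) (at s within {a..b})"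
    if s: "s \<in> {a..b}" for s
  proof -
    have comp_ix: "((\<lambda>s. ?z s $ ix i) has_real_derivative D (\<xi> s) (f (\<xi> s) + u s *\<^sub>R g (\<xi> s)) $ ix i)
            (at s within {a..b})" if i: "i \<in> {1..CARD('n)}" for i
    proof -
      have rhs: "D (\<xi> s) (f (\<xi> s) + u s *\<^sub>R g (\<xi> s)) $ ix i
              = D (\<xi> s) (f (\<xi> s)) $ ix i + u s * D (\<xi> s) (g (\<xi> s)) $ ix i"
        by (simp add: blinfun.add_right blinfun.scaleR_right)
      consider "i < r" | "i = r" | "i > r" by linarith
      then show ?thesis
      proof cases
        case 1
        then have S: "Suc (i - 1) = i" "i - 1 < r" using i by auto
        have "D (\<xi> s) (f (\<xi> s) + u s *\<^sub>R g (\<xi> s)) $ ix i = (lie f ^^ i) h (\<xi> s)"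
          using Df[OF S(2), of "\<xi> s"] Dg[OF S(2), of "\<xi> s"] lg0[of "i - 1" "\<xi> s"] 1 S
          by (simp add: rhs)
        also have "\<dots> = ?z s $ ix (Suc i)"
          using fun_cong[OF out[OF 1], of "\<xi> s"] \<Phi>\<xi>[OF s] by simp
        also have "\<dots> = (deriv ^^ Suc (i - 1)) y s"
          using nf_point_nth[OF ix, of "Suc i" r y e s] 1 i r(1) S by auto
        finally show ?thesis
          using has_field_derivative_at_within[OF y[of "i - 1" s]] 1
          by (simp add: nf_point_nth[OF ix i])
      next
        case 2
        then have S: "Suc (i - 1) = i" using i by auto
        have "D (\<xi> s) (f (\<xi> s) + u s *\<^sub>R g (\<xi> s)) $ ix i = (deriv ^^ Suc (i - 1)) y s"
          unfolding rhs using S 2 Dgr[of "\<xi> s"] by (simp add: u_eq del: funpow.simps)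
        then show ?thesis
          using has_field_derivative_at_within[OF y[of "i - 1" s]] 2 nf_point_nth[OF ix i]
          by simp
      next
        case 3
        have "((\<lambda>s. e s i) has_real_derivative
                nf_rate ix f g \<Phi> i (?z s) (u s)) (at s within {a..b})"
          using bvp s 3 i by (simp add: bvp_solution_def nf_beta_def u)
        then show ?thesis
          unfolding rhs rate \<xi>z using 3 by (simp add: nf_point_nth[OF ix i])
      qed
    qed
    have comp: "((\<lambda>s. ?z s $ c) has_real_derivative
        D (\<xi> s) (f (\<xi> s) + u s *\<^sub>R g (\<xi> s)) $ c) (at s within {a..b})" for c
    proof -
      have "c \<in> ix ` {1..CARD('n)}" using bij_betw_imp_surj_on[OF ix] by simp
      then obtain i where "i \<in> {1..CARD('n)}" "c = ix i" by blast
      with comp_ix show ?thesis by simp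
    qed
    show ?thesis using comp
      unfolding has_vector_derivative_def has_field_derivative_def
      by (subst has_derivative_componentwise_within)
         (auto simp: Basis_vec_def inner_axis mult_commute_abs)
  qed
  show traj: "(\<xi> has_vector_derivative f (\<xi> s) + u s *\<^sub>R g (\<xi> s)) (at s within {a..b})"
    if s: "s \<in> {a..b}" for s
  proof -
    have "((inv \<Phi> \<circ> ?z) has_vector_derivative
             D' (?z s) (D (\<xi> s) (f (\<xi> s) + u s *\<^sub>R g (\<xi> s)))) (at s within {a..b})"
      by (rule vector_derivative_diff_chain_within[OF dz[OF s]
            has_derivative_at_withinI[OF D'[OF range[OF s]]]])
    then show ?thesis using D'D[of "\<xi> s"] \<Phi>\<xi>[OF s] by (simp add: o_def \<xi>_def)
  qed
  have c\<xi>: "continuous_on {a..b} \<xi>"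
    using traj by (rule continuous_on_vector_derivative)
  have "continuous_on {a..b} (\<lambda>s. D (\<xi> s))" "continuous_on {a..b} (\<lambda>s. f (\<xi> s))"
    "continuous_on {a..b} (\<lambda>s. g (\<xi> s))"
    using continuous_on_compose2[OF cD c\<xi>]
      continuous_on_compose2[OF C1_on_imp_continuous_on[OF C1(1)] c\<xi>]
      continuous_on_compose2[OF C1_on_imp_continuous_on[OF C1(2)] c\<xi>] by auto
  moreover have "continuous_on {a..b} ((deriv ^^ r) y)"
    by (intro continuous_at_imp_continuous_on ballI DERIV_isCont[OF y])
  ultimately show "continuous_on {a..b} u"
    unfolding u_eq using Dgr by (intro continuous_intros) auto
qed

theorem theorem1:
  fixes f g :: "real^'n \<Rightarrow> real^'n::finite" and h :: "real^'n \<Rightarrow> real"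
    and ix :: "nat \<Rightarrow> 'n" and \<Phi> :: "real^'n \<Rightarrow> real^'n" and r :: nat
    and y_min y_max \<delta> :: real and X :: "(real^'n) set"
    and J :: "real^'n \<Rightarrow> real" and gradJ :: "real^'n \<Rightarrow> real^'n"
    and L \<epsilon> \<rho> :: real and x :: "nat \<Rightarrow> real^'n" and t :: "nat \<Rightarrow> real"
    and \<gamma> :: "nat \<Rightarrow> real" and p :: "nat \<Rightarrow> nat \<Rightarrow> real"
    and y :: "nat \<Rightarrow> real \<Rightarrow> real" and \<eta> :: "nat \<Rightarrow> real \<Rightarrow> nat \<Rightarrow> real" and u :: "nat \<Rightarrow> real \<Rightarrow> real"
  assumes ix: "bij_betw ix {1..CARD('n)} UNIV"
    and smooth: "C1_on f UNIV" "C1_on g UNIV" "C1_on h UNIV"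
    and h_convex: "convex_on UNIV h"
    and bounds: "y_min < y_max"
    and X_def: "X = {z. h z \<in> {y_min..y_max}}"
    and X: "X \<noteq> {}" "closed X" "convex X"
    and r: "0 < r" "r \<le> CARD('n)" "relative_degree f g h r"
    and nf: "normal_form ix f g h r \<Phi>"
    and J_grad: "\<And>z. z \<in> X \<Longrightarrow> (J has_derivative (\<lambda>v. gradJ z \<bullet> v)) (at z within X)"
    and J_cont: "continuous_on X gradJ"
    and J_convex: "convex_on X J"
    and J_lipschitz: "L-lipschitz_on X gradJ"
    and J_min: "\<exists>z. is_arg_min J (\<lambda>z. z \<in> X) z"
    and eps: "\<epsilon> > 0" and step: "\<rho> = 2 / (L + 2 * \<epsilon>)"
    and x_0: "x 0 \<in> X"
    and x_Suc: "\<And>k. x (Suc k) = closest_point X (x k - \<rho> *\<^sub>R gradJ (x k))"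
    and t: "\<And>k. t k < t (Suc k)"
    and \<delta>: "\<delta> > 0"
    and \<gamma>: "\<And>i. i \<in> {1..CARD('n) - r} \<Longrightarrow> \<gamma> i > 0"
    and y_def: "\<And>k. y k = ref_output (y_min - \<delta>) (y_max + \<delta>) (CARD('n) - r) \<gamma> (p k)
                          (t k) (t (Suc k)) (h (x k)) (h (x (Suc k)))"
    and bvp: "\<And>k. bvp_solution ix f g \<Phi> r (t k) (t (Suc k)) (x k) (x (Suc k)) (y k) (\<eta> k)"
    and y_compatible: "\<And>k i. \<lbrakk>1 \<le> i; i < r\<rbrakk> \<Longrightarrow>
                          (deriv ^^ i) (y k) (t k) = (lie f ^^ i) h (x k) \<and>
                          (deriv ^^ i) (y k) (t (Suc k)) = (lie f ^^ i) h (x (Suc k))"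
    and u_def: "\<And>k. u k = ff_input ix f g \<Phi> r (y k) (\<eta> k)"
  shows "(\<exists>\<xi>. state_trajectory f g t u \<xi> \<and> \<xi> (t 0) = x 0) \<and>
         (\<forall>\<xi>. state_trajectory f g t u \<xi> \<and> \<xi> (t 0) = x 0 \<longrightarrow> (\<forall>k. \<xi> (t k) = x k)) \<and>
         (\<exists>z. is_arg_min J (\<lambda>z. z \<in> X) z \<and> x \<longlonglongrightarrow> z)"
proof (intro conjI allI impI)
  show "\<exists>z. is_arg_min J (\<lambda>z. z \<in> X) z \<and> x \<longlonglongrightarrow> z"
    by (rule projected_gradient_converges[where x = x and F = J and G = gradJ,
          OF X(2) J_convex J_grad J_lipschitz J_min eps step x_0 x_Suc])
  have xX: "x k \<in> X" for k
    using x_0 X by (cases k) (auto simp: x_Suc intro!: closest_point_in_set)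
  have hx: "y_min - \<delta> < h (x k)" "h (x k) < y_max + \<delta>" for k
    using xX[of k] \<delta> by (auto simp: X_def)
  \<comment> \<open>order \<open>0\<close> holds by construction of the reference output, as \<open>h (x k)\<close> lies strictly
    inside its range\<close>
  have y_ends: "(deriv ^^ i) (y k) (t k) = (lie f ^^ i) h (x k)"
    "(deriv ^^ i) (y k) (t (Suc k)) = (lie f ^^ i) h (x (Suc k))" if "i < r" for i k
    using y_compatible[of i k] that hx t
    by (cases "i = 0"; simp add: y_def ref_output_endpoints)+
  define \<Xi> where "\<Xi> = (\<lambda>k s. inv \<Phi> (nf_point ix r (y k) (\<eta> k) s))"
  have y_smooth: "((deriv ^^ i) (y k) has_real_derivative (deriv ^^ Suc i) (y k) s) (at s)"
    for i k s unfolding y_def by (rule ref_output_smooth)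
  note inversion = feedforward_solves_system[OF ix smooth(1,2) r(2,3) nf y_smooth bvp y_ends u_def]
  have \<Xi>_ends: "\<Xi> k (t k) = x k" "\<Xi> k (t (Suc k)) = x (Suc k)" for k
    unfolding \<Xi>_def by (rule inversion(1), assumption+) (rule inversion(2), assumption+)
  have \<Xi>_ode: "(\<Xi> k has_vector_derivative f (\<Xi> k s) + u k s *\<^sub>R g (\<Xi> k s))
      (at s within {t k..t (Suc k)})" if "s \<in> {t k..t (Suc k)}" for k s
    using that unfolding \<Xi>_def by (rule inversion(3)[rotated 2])
  have u_cont: "continuous_on {t k..t (Suc k)} (u k)" for k
    by (rule inversion(4))
  have "\<exists>\<xi>. \<forall>k. \<forall>s\<in>{t k..t (Suc k)}. \<xi> s = \<Xi> k s"
    by (rule glue_pieces[where t = t and \<Xi> = \<Xi>]) (simp_all add: t \<Xi>_ends)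
  then obtain \<xi> where \<xi>: "\<And>k s. s \<in> {t k..t (Suc k)} \<Longrightarrow> \<xi> s = \<Xi> k s"
    by blast
  have "state_trajectory f g t u \<xi>"
    unfolding state_trajectory_def
  proof (intro allI ballI)
    fix k s assume s: "s \<in> {t k..t (Suc k)}"
    show "(\<xi> has_vector_derivative f (\<xi> s) + u k s *\<^sub>R g (\<xi> s)) (at s within {t k..t (Suc k)})"
      using has_vector_derivative_transform[OF s \<xi> \<Xi>_ode[OF s]] s \<xi> by simp
  qed
  moreover have "\<xi> (t 0) = x 0" using \<xi>[of "t 0" 0] t[of 0] \<Xi>_ends(1)[of 0] by simp
  ultimately show "\<exists>\<xi>. state_trajectory f g t u \<xi> \<and> \<xi> (t 0) = x 0" by blast

  fix \<xi> k
  assume \<xi>: "state_trajectory f g t u \<xi> \<and> \<xi> (t 0) = x 0"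
  show "\<xi> (t k) = x k"
  proof (induction k)
    case 0
    show ?case using \<xi> by simp
  next
    case (Suc k)
    have "\<xi> (t (Suc k)) = \<Xi> k (t (Suc k))"
      by (rule control_affine_solution_unique[OF smooth(1,2) u_cont _ \<Xi>_ode])
         (use \<xi> Suc t[of k] \<Xi>_ends(1)[of k] in \<open>auto simp: state_trajectory_def\<close>)
    then show ?case by (simp add: \<Xi>_ends(2))
  qed
qed

end
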